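(* Let $G$ be a simple graph without isolated vertices, with $m(G)$ edges and arranged degree sequence $d_1\ge d_2\ge\cdots\ge d_n$. Let $$k^*=\min\Big\{k\in\mathbb{N},\ 2k\le n\ :\ \sum_{i=1}^{2k}d_i-m(G)-k\ge 0\Big\}.$$ Then every maximal matching $M$ of $G$ satisfies $|M|\ge k^*$. Consequently, every realization of this degree sequence contains a matching of size $k^*$ (the degree sequence is forcibly $k^*$-matching graphic).
   Context: A matching is a set of pairwise disjoint edges; it is maximal if it is not a proper subset of another matching. A realization of a degree sequence is a simple graph (with vertex labelling) having that degree sequence. *)

theory Defs
  imports Main
begin

definition simple_graph :: "'a set \<Rightarrow> 'a set set \<Rightarrow> bool" where
  "simple_graph V E \<longleftrightarrow> finite V \<and> (\<forall>e\<in>E. e \<subseteq> V \<and> card e = 2)"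

definition degree :: "'a set set \<Rightarrow> 'a \<Rightarrow> nat" where
  "degree E v = card {e \<in> E. v \<in> e}"

definition isolated :: "'a set set \<Rightarrow> 'a \<Rightarrow> bool" where
  "isolated E v \<longleftrightarrow> (\<forall>e\<in>E. v \<notin> e)"

definition matching :: "'a set set \<Rightarrow> 'a set set \<Rightarrow> bool" where
  "matching E M \<longleftrightarrow> M \<subseteq> E \<and> pairwise disjnt M"

definition maximal_matching :: "'a set set \<Rightarrow> 'a set set \<Rightarrow> bool" where
  "maximal_matching E M \<longleftrightarrow> matching E M \<and> \<not> (\<exists>M'. matching E M' \<and> M \<subset> M')"

text \<open>A realization of a sequence is a simple graph admitting a labelling of its vertices
  under which the i-th vertex has the i-th entry as its degree. The sequence
  $d_1, \dots, d_n$ is the list \<open>d\<close>, so \<open>d ! i\<close> is $d_{i+1}$ and \<open>length d\<close> is $n$.\<close>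

definition realization :: "nat list \<Rightarrow> 'a set \<Rightarrow> 'a set set \<Rightarrow> bool" where
  "realization d V E \<longleftrightarrow> simple_graph V E \<and>
     (\<exists>v. bij_betw v {..<length d} V \<and> (\<forall>i<length d. degree E (v i) = d ! i))"

text \<open>The vertices of a realization can be taken to be natural numbers, because every
  realization is finite and hence isomorphic to one of this kind.\<close>

definition graphic :: "nat list \<Rightarrow> bool" where
  "graphic d \<longleftrightarrow> (\<exists>(V :: nat set) E. realization d V E)"

definition forcibly_matching_graphic :: "nat \<Rightarrow> nat list \<Rightarrow> bool" where
  "forcibly_matching_graphic k d \<longleftrightarrow> graphic d \<and>
     (\<forall>(V :: nat set) E. realization d V E \<longrightarrow> (\<exists>M. matching E M \<and> card M = k))"

text \<open>The argument \<open>m\<close> is the number of edges. The inequality is stated over the integers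
  because subtraction on the naturals truncates.\<close>

definition k_star :: "nat list \<Rightarrow> nat \<Rightarrow> nat" where
  "k_star d m = Min {k. 2 * k \<le> length d \<and> (\<Sum>i<2 * k. int (d ! i)) - int m - int k \<ge> 0}"

end

theory Submission
  imports Defs
begin

text \<open>The vertices covered by a maximal matching \<open>M\<close> form a vertex cover \<open>C\<close> of size \<open>2 |M|\<close>. In the
  degree sum over \<open>C\<close> every edge is counted at least once, and the edges of \<open>M\<close> are counted twice, so
  this sum is at least \<open>m + |M|\<close>. The sum of the \<open>2 |M|\<close> largest degrees is at least as large, so
  \<open>|M|\<close> lies in the set whose minimum is \<open>k\<^sup>*\<close>. Since \<open>m\<close> is determined by the degree sequence, the
  same bound holds in every realization.\<close>

lemma simple_graph_finite_edges:
  assumes "simple_graph V E"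
  shows "finite E"
proof (rule finite_subset)
  show "E \<subseteq> Pow V" and "finite (Pow V)"
    using assms by (auto simp: simple_graph_def)
qed

text \<open>Double counting of the pairs \<open>(v, e)\<close> with \<open>v\<close> in
  \<open>A\<close> and \<open>v \<in> e\<close>. The case of all vertices is the handshake lemma;
  the case \<open>A = \<Union>M\<close> drives the main estimate.\<close>

lemma sum_degree:
  assumes "finite E" "finite A"
  shows "(\<Sum>v\<in>A. degree E v) = (\<Sum>e\<in>E. card (e \<inter> A))"
proof -
  have "(\<Sum>v\<in>A. degree E v) = (\<Sum>v\<in>A. \<Sum>e\<in>E. if v \<in> e then 1 else 0)"
    using assms by (simp add: degree_def sum.If_cases Int_def)
  also have "\<dots> = (\<Sum>e\<in>E. \<Sum>v\<in>A. if v \<in> e then 1 else 0)"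
    by (rule sum.swap)
  also have "\<dots> = (\<Sum>e\<in>E. card (e \<inter> A))"
    using assms by (simp add: sum.If_cases Int_def conj_commute)
  finally show ?thesis .
qed

lemma handshake:
  assumes "simple_graph V E"
  shows "(\<Sum>v\<in>V. degree E v) = 2 * card E"
proof -
  have "(\<Sum>v\<in>V. degree E v) = (\<Sum>e\<in>E. card (e \<inter> V))"
    using assms simple_graph_finite_edges[OF assms] by (simp add: sum_degree simple_graph_def)
  also have "\<dots> = (\<Sum>e\<in>E. 2)"
    using assms by (intro sum.cong refl) (simp add: simple_graph_def Int_absorb2)
  finally show ?thesis by simp
qed

lemma realization_card_edges:
  assumes "realization d V E"
  shows "2 * card E = sum_list d"
proof -
  obtain v where v: "bij_betw v {..<length d} V" "\<forall>i<length d. degree E (v i) = d ! i"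
    and "simple_graph V E"
    using assms by (auto simp: realization_def)
  then have "2 * card E = (\<Sum>i<length d. degree E (v i))"
    using handshake sum.reindex_bij_betw[OF v(1), of "degree E"] by metis
  also have "\<dots> = sum_list d"
    using v(2) by (simp add: sum_list_sum_nth atLeast0LessThan)
  finally show ?thesis .
qed

text \<open>Allows \<open>k_star\<close>, computed from the edges of one realization, to be used for
  another, possibly over a different vertex type.\<close>

lemma realizations_card_edges_eq:
  assumes "realization d V E" "realization d W F"
  shows "card E = card F"
  using realization_card_edges[OF assms(1)] realization_card_edges[OF assms(2)] by simp

text \<open>Induction on the size of \<open>I\<close>, removing its largest index. Among
  \<open>Suc j\<close> distinct indices the largest is at least \<open>j\<close>, so in a
  nonincreasing list its entry is at most \<open>d ! j\<close>, the last term of the prefix.\<close>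

lemma sum_nth_le_sum_prefix:
  fixes d :: "nat list"
  assumes "sorted_wrt (\<ge>) d" "I \<subseteq> {..<length d}"
  shows "(\<Sum>i\<in>I. d ! i) \<le> (\<Sum>i<card I. d ! i)"
  using assms(2)
proof (induction "card I" arbitrary: I)
  case 0
  \<comment> \<open>An infinite set also has \<open>card\<close> 0, so finiteness has to come from
    the bound on \<open>I\<close>.\<close>
  then have "I = {}"
    using finite_subset[of I "{..<length d}"] by simp
  then show ?case by simp
next
  case (Suc j)
  define x where "x = Max I"
  have "finite I" "I \<noteq> {}"
    using Suc.hyps(2) by (auto intro: card_ge_0_finite)
  then have "x \<in> I" "I \<subseteq> {..x}"
    by (auto simp: x_def)
  then have "Suc j \<le> Suc x"
    using card_mono[of "{..x}" I] Suc.hyps(2) by simp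
  moreover have "x < length d"
    using \<open>x \<in> I\<close> Suc.prems by auto
  \<comment> \<open>Sortedness compares only distinct positions, hence the case
    \<open>j = x\<close>.\<close>
  ultimately have "d ! x \<le> d ! j"
    using assms(1) by (cases "j = x") (auto simp: sorted_wrt_iff_nth_less)
  moreover have "card (I - {x}) = j"
    using Suc.hyps(2) \<open>finite I\<close> \<open>x \<in> I\<close> by simp
  then have "(\<Sum>i\<in>I - {x}. d ! i) \<le> (\<Sum>i<j. d ! i)"
    using Suc.hyps(1)[of "I - {x}"] Suc.prems by auto
  ultimately have "(\<Sum>i\<in>I. d ! i) \<le> (\<Sum>i<Suc j. d ! i)"
    using \<open>finite I\<close> \<open>x \<in> I\<close> by (simp add: sum.remove[of I x])
  then show ?case
    by (simp only: Suc.hyps(2))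
qed

lemma realization_sum_degree_le:
  assumes "realization d V E" "sorted_wrt (\<ge>) d" "A \<subseteq> V"
  shows "(\<Sum>v\<in>A. degree E v) \<le> (\<Sum>i<card A. d ! i)"
proof -
  obtain v where v: "bij_betw v {..<length d} V" "\<forall>i<length d. degree E (v i) = d ! i"
    using assms(1) by (auto simp: realization_def)
  obtain I where I: "I \<subseteq> {..<length d}" "A = v ` I"
    using assms(3) v(1) by (metis bij_betw_imp_surj_on subset_imageE)
  then have inj: "inj_on v I"
    using v(1) by (meson bij_betw_def inj_on_subset)
  have "(\<Sum>v\<in>A. degree E v) = (\<Sum>i\<in>I. degree E (v i))"
    using inj by (simp add: I(2) sum.reindex)
  also have "\<dots> = (\<Sum>i\<in>I. d ! i)"
    using I(1) v(2) by (intro sum.cong) auto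
  also have "\<dots> \<le> (\<Sum>i<card A. d ! i)"
    using sum_nth_le_sum_prefix[OF assms(2) I(1)] inj by (simp add: I(2) card_image)
  finally show ?thesis .
qed

lemma matching_card_Union:
  assumes "simple_graph V E" "matching E M"
  shows "card (\<Union>M) = 2 * card M"
proof -
  have "M \<subseteq> E" "pairwise disjnt M"
    using assms(2) by (auto simp: matching_def)
  then have "card (\<Union>M) = (\<Sum>e\<in>M. card e)"
    using assms(1) by (intro card_Union_disjoint) (auto simp: simple_graph_def intro: finite_subset)
  also have "\<dots> = (\<Sum>e\<in>M. 2)"
    using \<open>M \<subseteq> E\<close> assms(1) by (intro sum.cong) (auto simp: simple_graph_def)
  finally show ?thesis by simp
qed

text \<open>Otherwise \<open>e\<close> could be added to \<open>M\<close>, against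
  maximality.\<close>

lemma maximal_matching_covers:
  assumes "maximal_matching E M" "e \<in> E" "e \<noteq> {}"
  shows "e \<inter> \<Union>M \<noteq> {}"
proof
  assume disj: "e \<inter> \<Union>M = {}"
  \<comment> \<open>Nonemptiness enters here: the empty set is disjoint from
    \<open>\<Union>M\<close> even when it belongs to \<open>M\<close>.\<close>
  then have "e \<notin> M"
    using assms(3) by auto
  moreover have "matching E (insert e M)"
    using assms(1,2) disj
    by (auto simp: maximal_matching_def matching_def pairwise_insert disjnt_def)
  ultimately show False
    using assms(1) by (auto simp: maximal_matching_def)
qed

lemma k_star_le_card_maximal_matching:
  assumes "realization d V E" "sorted_wrt (\<ge>) d" "maximal_matching E M"
  shows "k_star d (card E) \<le> card M"
proof -
  have G: "simple_graph V E"
    using assms(1) by (simp add: realization_def)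
  have M: "matching E M" "M \<subseteq> E"
    using assms(3) by (auto simp: maximal_matching_def matching_def)
  have "finite E" "finite V"
    using G simple_graph_finite_edges by (auto simp: simple_graph_def)
  have "\<Union>M \<subseteq> V"
    using G M(2) by (auto simp: simple_graph_def)
  then have "finite (\<Union>M)"
    using \<open>finite V\<close> by (rule finite_subset)
  \<comment> \<open>Edge by edge form of the count: the 1 comes from the covering property, and the
    extra 1 from edges of \<open>M\<close>, both of whose ends lie in
    \<open>\<Union>M\<close>.\<close>
  have cover: "1 + (if e \<in> M then 1 else 0) \<le> card (e \<inter> \<Union>M)" if "e \<in> E" for e
  proof (cases "e \<in> M")
    case True
    then show ?thesis
      using G that by (simp add: simple_graph_def Int_absorb2 Union_upper)
  next
    case False
    have "e \<noteq> {}"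
      using G that by (auto simp: simple_graph_def)
    then have "card (e \<inter> \<Union>M) \<noteq> 0"
      using maximal_matching_covers[OF assms(3) that] \<open>finite (\<Union>M)\<close> by simp
    then show ?thesis
      using False by simp
  qed
  have "card E + card M = (\<Sum>e\<in>E. 1 + (if e \<in> M then 1 else 0))"
    using M(2) \<open>finite E\<close> by (subst sum.distrib) (simp add: sum.If_cases Int_absorb1)
  also have "\<dots> \<le> (\<Sum>e\<in>E. card (e \<inter> \<Union>M))"
    using cover by (rule sum_mono)
  also have "\<dots> = (\<Sum>v\<in>\<Union>M. degree E v)"
    using \<open>finite E\<close> \<open>finite (\<Union>M)\<close> by (simp add: sum_degree)
  also have "\<dots> \<le> (\<Sum>i<2 * card M. d ! i)"
    using realization_sum_degree_le[OF assms(1,2) \<open>\<Union>M \<subseteq> V\<close>] matching_card_Union[OF G M(1)] by simp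
  finally have "int (card E + card M) \<le> int (\<Sum>i<2 * card M. d ! i)"
    by (simp only: of_nat_le_iff)
  moreover have "card V = length d"
    using assms(1) by (auto simp: realization_def dest: bij_betw_same_card)
  then have "2 * card M \<le> length d"
    using card_mono[OF \<open>finite V\<close> \<open>\<Union>M \<subseteq> V\<close>] matching_card_Union[OF G M(1)] by simp
  \<comment> \<open>This membership also shows that the set under \<open>Min\<close> is nonempty, so
    that \<open>k_star\<close> is a genuine minimum; finiteness follows from k \<le> 2k \<le>
    n.\<close>
  ultimately have "card M \<in> {k. 2 * k \<le> length d \<and> (\<Sum>i<2 * k. int (d ! i)) - int (card E) - int k \<ge> 0}"
    by simp
  moreover have "finite {k. 2 * k \<le> length d \<and> (\<Sum>i<2 * k. int (d ! i)) - int (card E) - int k \<ge> 0}"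
    by (rule finite_subset[of _ "{..length d}"]) auto
  ultimately show ?thesis
    unfolding k_star_def by (intro Min_le)
qed

lemma maximal_matching_exists:
  assumes "finite E"
  shows "\<exists>M. maximal_matching E M"
proof -
  have "finite {M. matching E M}"
    by (rule finite_subset[of _ "Pow E"]) (use assms in \<open>auto simp: matching_def\<close>)
  moreover have "matching E {}"
    by (simp add: matching_def)
  ultimately obtain M where "matching E M" "\<And>M'. matching E M' \<Longrightarrow> M \<subseteq> M' \<Longrightarrow> M' = M"
    using finite_has_maximal[of "{M. matching E M}"] by auto
  then show ?thesis
    by (auto simp: maximal_matching_def)
qed

lemma matching_subset:
  assumes "matching E M" "N \<subseteq> M"
  shows "matching E N"
  using assms by (auto simp: matching_def intro: pairwise_subset)

text \<open>Some maximal matching exists and is large enough; discarding edges from it leaves a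
  matching of exactly the required size.\<close>

lemma realization_matching_k_star:
  assumes "realization d V E" "sorted_wrt (\<ge>) d"
  shows "\<exists>M. matching E M \<and> card M = k_star d (card E)"
proof -
  have "finite E"
    using assms(1) simple_graph_finite_edges by (auto simp: realization_def)
  then obtain M where M: "maximal_matching E M"
    using maximal_matching_exists by blast
  obtain N where "N \<subseteq> M" "card N = k_star d (card E)"
    using obtain_subset_with_card_n[OF k_star_le_card_maximal_matching[OF assms M]] by metis
  then show ?thesis
    using M matching_subset unfolding maximal_matching_def by blast
qed

text \<open>\<open>graphic\<close> asks for natural numbers as vertices, so the given graph is
  copied onto the index set by renaming each vertex to its position in \<open>d\<close>.\<close>

lemma realization_imp_graphic:
  assumes "realization d V E"
  shows "graphic d"
proof -
  obtain v where v: "bij_betw v {..<length d} V" "\<forall>i<length d. degree E (v i) = d ! i"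
    and G: "simple_graph V E"
    using assms by (auto simp: realization_def)
  define g where "g = the_inv_into {..<length d} v"
  have g: "bij_betw g V {..<length d}" and gv: "\<And>i. i < length d \<Longrightarrow> g (v i) = i"
    unfolding g_def using v(1) bij_betw_the_inv_into
    by (auto simp: bij_betw_def the_inv_into_f_f)
  have inj: "inj_on g V"
    using g by (rule bij_betw_imp_inj_on)
  have sub: "e \<subseteq> V" if "e \<in> E" for e
    using G that by (auto simp: simple_graph_def)
  have "simple_graph {..<length d} ((`) g ` E)"
    using G g inj
    by (auto simp: simple_graph_def bij_betw_def card_image inj_on_subset)
  moreover have "degree ((`) g ` E) i = d ! i" if i: "i < length d" for i
  proof -
    have "v i \<in> V"
      using v(1) i by (auto simp: bij_betw_def)
    then have mem: "i \<in> g ` e \<longleftrightarrow> v i \<in> e" if "e \<in> E" for e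
      using inj_on_image_mem_iff[OF inj _ sub[OF that]] gv[OF i] by metis
    then have "{e \<in> (`) g ` E. i \<in> e} = (`) g ` {e \<in> E. v i \<in> e}"
      by auto
    \<comment> \<open>Distinct edges must keep distinct images, or degrees could drop.\<close>
    moreover have "inj_on ((`) g) {e \<in> E. v i \<in> e}"
      by (rule inj_on_subset[OF inj_on_image_Pow[OF inj]]) (use sub in auto)
    ultimately show ?thesis
      using v(2) i by (simp add: degree_def card_image)
  qed
  \<comment> \<open>After the renaming, the identity serves as the labelling.\<close>
  ultimately have "realization d {..<length d} ((`) g ` E)"
    by (auto simp: realization_def intro!: exI[of _ id])
  then show ?thesis
    unfolding graphic_def by blast
qed

theorem theorem4p4:
  fixes V :: "'a set" and E :: "'a set set" and d :: "nat list"
  assumes "simple_graph V E"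
    and "\<And>v. v \<in> V \<Longrightarrow> \<not> isolated E v"
    and "realization d V E"
    and "sorted_wrt (\<ge>) d"
  shows "(\<forall>M. maximal_matching E M \<longrightarrow> card M \<ge> k_star d (card E))
    \<and> (\<forall>(W :: 'b set) F. realization d W F \<longrightarrow>
          (\<exists>M. matching F M \<and> card M = k_star d (card E)))
    \<and> forcibly_matching_graphic (k_star d (card E)) d"
proof (intro conjI allI impI)
  show "k_star d (card E) \<le> card M" if "maximal_matching E M" for M
    using assms(3,4) that by (rule k_star_le_card_maximal_matching)
  show "\<exists>M. matching F M \<and> card M = k_star d (card E)" if "realization d W F" for W :: "'b set" and F
    using realization_matching_k_star[OF that assms(4)]
    unfolding realizations_card_edges_eq[OF that assms(3)] .
  \<comment> \<open>The type \<open>'b\<close> is fixed inside this proof, so the instance for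
    \<open>nat\<close> is derived anew.\<close>
  have "\<exists>M. matching F M \<and> card M = k_star d (card E)" if "realization d W F" for W :: "nat set" and F
    using realization_matching_k_star[OF that assms(4)]
    unfolding realizations_card_edges_eq[OF that assms(3)] .
  then show "forcibly_matching_graphic (k_star d (card E)) d"
    using realization_imp_graphic[OF assms(3)] by (auto simp: forcibly_matching_graphic_def)
qed

end
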